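(* Let $G$ be a group and let $n$ be the cardinality of the set of path-components of $|L(G)|$. Then $H_1(|\mathcal{C}(G)|;\mathbb{Z})$ has rank at least $n-1$ (infinite rank if $n$ is infinite). In particular, if $|L(G)|$ is disconnected then $|\mathcal{C}(G)|$ is not simply connected.
   Context: For a group $G$, the coset poset $\mathcal{C}(G)$ is the set of left cosets of all proper subgroups of $G$ (including the trivial subgroup), ordered by inclusion; $L(G)$ is the poset of proper nontrivial subgroups of $G$ ordered by inclusion; $|P|$ denotes the geometric realization of the order complex (chains) of $P$. *)

theory Defs
  imports "HOL-Homology.Homology" "HOL-Algebra.Coset"
begin

definition chains_of :: "'b set \<Rightarrow> ('b \<Rightarrow> 'b \<Rightarrow> bool) \<Rightarrow> 'b set set" where
  "chains_of P leq = {\<sigma>. finite \<sigma> \<and> \<sigma> \<noteq> {} \<and> \<sigma> \<subseteq> P \<and> (\<forall>x\<in>\<sigma>. \<forall>y\<in>\<sigma>. leq x y \<or> leq y x)}"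

definition simplex_of :: "'b set \<Rightarrow> ('b \<Rightarrow> real) set" where
  "simplex_of \<sigma> = {\<alpha>. (\<forall>x. x \<notin> \<sigma> \<longrightarrow> \<alpha> x = 0) \<and> (\<forall>x. 0 \<le> \<alpha> x) \<and> sum \<alpha> \<sigma> = 1}"

text \<open>Geometric realization of the order complex of (P, leq), with the weak (coherent)
  topology: a set is open iff its trace on every closed simplex is open in the
  Euclidean topology of that simplex.\<close>
definition order_complex_realization :: "'b set \<Rightarrow> ('b \<Rightarrow> 'b \<Rightarrow> bool) \<Rightarrow> ('b \<Rightarrow> real) topology" where
  "order_complex_realization P leq = topology (\<lambda>U.
      U \<subseteq> (\<Union>\<sigma>\<in>chains_of P leq. simplex_of \<sigma>) \<and>
      (\<forall>\<sigma>\<in>chains_of P leq. openin (subtopology (powertop_real UNIV) (simplex_of \<sigma>)) (U \<inter> simplex_of \<sigma>)))"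

lemma istopology_order_complex_realization:
  fixes P :: "'b set" and leq :: "'b \<Rightarrow> 'b \<Rightarrow> bool"
  shows "istopology (\<lambda>U. U \<subseteq> (\<Union>\<sigma>\<in>chains_of P leq. simplex_of \<sigma>) \<and>
      (\<forall>\<sigma>\<in>chains_of P leq. openin (subtopology (powertop_real UNIV) (simplex_of \<sigma>)) (U \<inter> simplex_of \<sigma>)))"
  unfolding istopology_def
proof (intro conjI allI impI ballI)
  fix S T :: "('b \<Rightarrow> real) set" and \<sigma>
  assume S: "S \<subseteq> (\<Union>\<sigma>\<in>chains_of P leq. simplex_of \<sigma>) \<and>
      (\<forall>\<sigma>\<in>chains_of P leq. openin (subtopology (powertop_real UNIV) (simplex_of \<sigma>)) (S \<inter> simplex_of \<sigma>))"
    and T: "T \<subseteq> (\<Union>\<sigma>\<in>chains_of P leq. simplex_of \<sigma>) \<and>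
      (\<forall>\<sigma>\<in>chains_of P leq. openin (subtopology (powertop_real UNIV) (simplex_of \<sigma>)) (T \<inter> simplex_of \<sigma>))"
  show "S \<inter> T \<subseteq> (\<Union>\<sigma>\<in>chains_of P leq. simplex_of \<sigma>)" using S by blast
  assume "\<sigma> \<in> chains_of P leq"
  then have "openin (subtopology (powertop_real UNIV) (simplex_of \<sigma>)) ((S \<inter> simplex_of \<sigma>) \<inter> (T \<inter> simplex_of \<sigma>))"
    using S T \<open>\<sigma> \<in> chains_of P leq\<close> by (meson openin_Int)
  then show "openin (subtopology (powertop_real UNIV) (simplex_of \<sigma>)) (S \<inter> T \<inter> simplex_of \<sigma>)"
    by (simp add: Int_ac)
next
  fix K :: "('b \<Rightarrow> real) set set" and \<sigma>
  assume K: "\<forall>U\<in>K. U \<subseteq> (\<Union>\<sigma>\<in>chains_of P leq. simplex_of \<sigma>) \<and>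
      (\<forall>\<sigma>\<in>chains_of P leq. openin (subtopology (powertop_real UNIV) (simplex_of \<sigma>)) (U \<inter> simplex_of \<sigma>))"
  show "\<Union>K \<subseteq> (\<Union>\<sigma>\<in>chains_of P leq. simplex_of \<sigma>)" using K by blast
  assume "\<sigma> \<in> chains_of P leq"
  then have "openin (subtopology (powertop_real UNIV) (simplex_of \<sigma>)) (\<Union>((\<lambda>U. U \<inter> simplex_of \<sigma>) ` K))"
    using K by (intro openin_Union) auto
  moreover have "\<Union>((\<lambda>U. U \<inter> simplex_of \<sigma>) ` K) = \<Union>K \<inter> simplex_of \<sigma>" by blast
  ultimately show "openin (subtopology (powertop_real UNIV) (simplex_of \<sigma>)) (\<Union>K \<inter> simplex_of \<sigma>)" by simp
qed

definition subgroup_poset :: "('a, 'm) monoid_scheme \<Rightarrow> 'a set set" where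
  "subgroup_poset G = {H. subgroup H G \<and> H \<noteq> carrier G \<and> H \<noteq> {\<one>\<^bsub>G\<^esub>}}"

definition coset_poset :: "('a, 'm) monoid_scheme \<Rightarrow> 'a set set" where
  "coset_poset G = {x <#\<^bsub>G\<^esub> H | x H. x \<in> carrier G \<and> subgroup H G \<and> H \<noteq> carrier G}"

text \<open>Simple connectivity of a topological space (mirrors the library notion
  simply_connected: any two loops are homotopic as loops).\<close>
definition simply_connected_space :: "'a topology \<Rightarrow> bool" where
  "simply_connected_space X \<longleftrightarrow>
     (\<forall>p q. pathin X p \<and> p 1 = p 0 \<and> pathin X q \<and> q 1 = q 0 \<longrightarrow>
        homotopic_with (\<lambda>r. r 1 = r 0) (top_of_set {0..1}) X p q)"

definition Z_independent :: "('a, 'm) monoid_scheme \<Rightarrow> (nat \<Rightarrow> 'a) \<Rightarrow> nat \<Rightarrow> bool" where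
  "Z_independent A g k \<longleftrightarrow> (\<forall>i<k. g i \<in> carrier A) \<and>
     (\<forall>c :: nat \<Rightarrow> int. finprod A (\<lambda>i. g i [^]\<^bsub>A\<^esub> c i) {..<k} = \<one>\<^bsub>A\<^esub> \<longrightarrow> (\<forall>i<k. c i = 0))"

end

theory Submission
  imports Defs
begin

text \<open>The link of the vertex \<open>{1}\<close> in \<open>|C(G)|\<close> is \<open>|L(G)|\<close>, and removing that vertex leaves all of
  \<open>|L(G)|\<close> in one path component: for proper nontrivial subgroups \<open>H\<close>, \<open>K\<close> and nontrivial elements
  \<open>h\<close>, \<open>k\<close> of them, the cosets \<open>H, {h}, hK, {hk}, Hk, {k}, K\<close> form a path. Hence, fixing one component
  as a base, every other component \<open>A\<close> of \<open>|L(G)|\<close> gives a loop that leaves \<open>{1}\<close> through the base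
  component and returns to it through \<open>A\<close>. Mapping the edges from \<open>{1}\<close> to \<open>A\<close> once around the
  circle and collapsing the rest is continuous, and has degree 1 on the loop of \<open>A\<close> and degree 0 on
  the loops of the other components.\<close>

section \<open>Loops and the circle\<close>

declare One_nat_def [simp del] \<comment> \<open>otherwise the simplifier turns \<open>nsphere 1\<close> into \<open>nsphere (Suc 0)\<close>\<close>

text \<open>Angles are measured in turns, so \<open>{0..1}\<close> covers the circle once. Points of
  \<open>nsphere 1\<close> are real sequences supported on the coordinates 0 and 1, hence the value
  0 elsewhere.\<close>

definition circ :: "real \<Rightarrow> nat \<Rightarrow> real" where
  "circ t = (\<lambda>i. if i = 0 then cos (2 * pi * t) else if i = 1 then sin (2 * pi * t) else 0)"

lemma topspace_circle: "topspace (nsphere 1) = {x. (x 0)\<^sup>2 + (x 1)\<^sup>2 = 1 \<and> (\<forall>i>1. x i = 0)}"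
  by (auto simp: nsphere One_nat_def)

lemma continuous_map_circ: "continuous_map euclideanreal (nsphere 1) circ"
proof -
  have "continuous_map euclideanreal euclideanreal (\<lambda>t. circ t i)" for i
    by (cases "i = 0"; cases "i = 1") (auto simp: circ_def intro!: continuous_intros)
  then have "continuous_map euclideanreal (powertop_real UNIV) circ"
    by (simp add: continuous_map_componentwise_UNIV)
  then show ?thesis
    by (auto simp: nsphere continuous_map_in_subtopology circ_def One_nat_def)
qed

lemma circ_surj:
  assumes "x \<in> topspace (nsphere 1)"
  obtains t where "0 \<le> t" "t \<le> 1" "circ t = x"
proof -
  have x: "(x 0)\<^sup>2 + (x 1)\<^sup>2 = 1" "\<And>i. i > 1 \<Longrightarrow> x i = 0"
    using assms by (auto simp: topspace_circle)
  obtain s where s: "0 \<le> s" "s \<le> 2 * pi" "x 0 = cos s" "x 1 = sin s"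
    using sincos_total_2pi_le [OF x(1)] by blast
  have "circ (s / (2 * pi)) i = x i" for i
    using s x(2)[of i] by (cases "i = 0"; cases "i = 1") (auto simp: circ_def)
  then show ?thesis
    using s by (intro that [of "s / (2 * pi)"]) auto
qed

text \<open>Equal sine and cosine mean that \<open>s\<close> and \<open>t\<close> differ by an
  integer, which inside \<open>{0..1}\<close> leaves only the two end points to be glued.\<close>

lemma circ_eq_imp:
  assumes "circ s = circ t" "s \<in> {0..1}" "t \<in> {0..1}"
  shows "s = t \<or> s = 0 \<and> t = 1 \<or> s = 1 \<and> t = 0"
proof -
  have "cos (2 * pi * s) = cos (2 * pi * t)" "sin (2 * pi * s) = sin (2 * pi * t)"
    using fun_cong [OF assms(1), of 0] fun_cong [OF assms(1), of 1] by (auto simp: circ_def)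
  then obtain n :: int where "2 * pi * s = 2 * pi * t + 2 * pi * n"
    using sin_cos_eq_iff by metis
  then have "2 * pi * s = 2 * pi * (t + n)"
    by (simp add: algebra_simps)
  then have n: "s = t + n"
    by (simp only: mult_cancel_left) auto
  then have "-1 \<le> n" "n \<le> 1"
    using assms by auto
  then consider "n = -1" | "n = 0" | "n = 1" by linarith
  then show ?thesis
    using n assms by cases auto
qed

lemma circ_1: "circ 1 = circ 0"
  by (auto simp: circ_def)

lemma Hausdorff_space_nsphere: "Hausdorff_space (nsphere n)"
  by (simp add: nsphere Hausdorff_space_subtopology Hausdorff_space_product_topology)

lemma circ_image: "circ ` {0..1} = topspace (nsphere 1)"
proof (rule antisym)
  show "circ ` {0..1} \<subseteq> topspace (nsphere 1)"
    using continuous_map_image_subset_topspace [OF continuous_map_circ] by auto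
  show "topspace (nsphere 1) \<subseteq> circ ` {0..1}"
  proof
    fix x assume "x \<in> topspace (nsphere 1)"
    then obtain t where "0 \<le> t" "t \<le> 1" "circ t = x"
      by (rule circ_surj)
    then show "x \<in> circ ` {0..1}" by auto
  qed
qed

text \<open>A continuous map from a compact space to a Hausdorff space is closed, and a closed
  continuous surjection is a quotient map.\<close>

lemma quotient_map_circ: "quotient_map (top_of_set {0..1}) (nsphere 1) circ"
  by (intro continuous_closed_imp_quotient_map continuous_imp_closed_map)
    (auto simp: continuous_map_circ continuous_map_from_subtopology Hausdorff_space_nsphere circ_image
      compact_space_subtopology)

text \<open>Turns loops into maps on \<open>nsphere 1\<close>, to which homology and degrees apply:
  a loop agrees at the only two points that \<open>circ\<close> glues.\<close>

lemma loop_factors_through_circle: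
  assumes "pathin X p" "p 1 = p 0"
  obtains g where "continuous_map (nsphere 1) X g" "\<And>t. t \<in> {0..1} \<Longrightarrow> g (circ t) = p t"
proof (rule quotient_map_lift_exists [OF quotient_map_circ assms(1)[unfolded pathin_def]])
  show "p x = p y"
    if "x \<in> topspace (top_of_set {0..1})" "y \<in> topspace (top_of_set {0..1})" "circ x = circ y" for x y
    using circ_eq_imp [OF that(3)] that assms(2) by auto
qed (use that in auto)

text \<open>The homotopy descends along \<open>circ\<close> in its second argument. Compactness
  makes the product of the identity with \<open>circ\<close> a quotient map too, and the homotopy is
  constant on its fibres because every stage is a loop.\<close>

lemma homotopic_loops_imp_homotopic_circle_maps:
  assumes "homotopic_with (\<lambda>r. r 1 = r 0) (top_of_set {0..1}) X p q"
    and f: "\<And>t. t \<in> {0..1} \<Longrightarrow> f (circ t) = p t"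
    and g: "\<And>t. t \<in> {0..1} \<Longrightarrow> g (circ t) = q t"
  shows "homotopic_with (\<lambda>x. True) (nsphere 1) X f g"
proof -
  let ?I = "top_of_set {0..1::real}"
  obtain h where h: "continuous_map (prod_topology ?I ?I) X h"
      "\<And>x. h (0, x) = p x" "\<And>x. h (1, x) = q x" "\<And>t. t \<in> {0..1} \<Longrightarrow> h (t, 1) = h (t, 0)"
    using assms(1) unfolding homotopic_with_def by auto
  let ?e = "\<lambda>(s, t). (s, circ t)"
  have c: "continuous_map (prod_topology ?I ?I) (prod_topology ?I (nsphere 1)) ?e"
    unfolding case_prod_unfold
    by (intro continuous_map_pairedI continuous_map_fst
        continuous_map_compose [OF continuous_map_snd, unfolded o_def]
        continuous_map_from_subtopology continuous_map_circ)
  have q: "quotient_map (prod_topology ?I ?I) (prod_topology ?I (nsphere 1)) ?e"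
  proof (rule continuous_closed_imp_quotient_map [OF c])
    show "closed_map (prod_topology ?I ?I) (prod_topology ?I (nsphere 1)) ?e"
      by (intro continuous_imp_closed_map c)
        (auto simp: compact_space_subtopology compact_Times Hausdorff_space_prod_topology
          Hausdorff_space_nsphere Hausdorff_space_subtopology)
    have "?e ` ({0..1} \<times> {0..1}) = {0..1} \<times> circ ` {0..1}"
      by force
    then show "?e ` topspace (prod_topology ?I ?I) = topspace (prod_topology ?I (nsphere 1))"
      by (simp add: circ_image)
  qed
  obtain k where k: "continuous_map (prod_topology ?I (nsphere 1)) X k"
      "\<And>x. x \<in> topspace (prod_topology ?I ?I) \<Longrightarrow> k (?e x) = h x"
  proof (rule quotient_map_lift_exists [OF q h(1)])
    show "h x = h y" if "x \<in> topspace (prod_topology ?I ?I)" "y \<in> topspace (prod_topology ?I ?I)" "?e x = ?e y" for x y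
    proof -
      obtain a b c d where xy: "x = (a, b)" "y = (c, d)" by (meson surj_pair)
      with that have "a = c" "circ b = circ d" "a \<in> {0..1}" "b \<in> {0..1}" "d \<in> {0..1}" by auto
      then show ?thesis
        using circ_eq_imp [of b d] h(4) [of a] xy by auto
    qed
  qed blast
  have k': "k (s, circ t) = h (s, t)" if "s \<in> {0..1}" "t \<in> {0..1}" for s t
    using k(2) [of "(s, t)"] that by simp
  \<comment> \<open>\<open>k\<close> matches \<open>f\<close> and \<open>g\<close> only on the
    circle itself, so the conclusion uses the form of \<open>homotopic_with\<close> that asks for
    equality on the topspace alone.\<close>
  have "k (0, x) = f x \<and> k (1, x) = g x" if x: "x \<in> topspace (nsphere 1)" for x
  proof -
    obtain t where "t \<in> {0..1}" "x = circ t"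
      using x unfolding circ_image [symmetric] by blast
    then show ?thesis
      by (simp add: k' h f g)
  qed
  then have "\<exists>k. continuous_map (prod_topology ?I (nsphere 1)) X k \<and>
      (\<forall>x\<in>topspace (nsphere 1). k (0, x) = f x) \<and> (\<forall>x\<in>topspace (nsphere 1). k (1, x) = g x) \<and>
      (\<forall>t\<in>{0..1}. True)"
    using k(1) by blast
  then show ?thesis
    by (subst homotopic_with) simp_all
qed

section \<open>Degrees and independence in homology\<close>

text \<open>The straight-line homotopy from \<theta> to the identity fixes the end values 0 and 1,
  so \<open>circ\<close> turns it into a homotopy of loops, and \<open>f\<close> is homotopic to
  \<open>id\<close>.\<close>

lemma Brouwer_degree2_circle:
  assumes "continuous_map (top_of_set {0..1}) euclideanreal \<theta>" "\<theta> 0 = 0" "\<theta> 1 = 1"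
    and f: "\<And>t. t \<in> {0..1} \<Longrightarrow> f (circ t) = circ (\<theta> t)"
  shows "Brouwer_degree2 1 f = 1"
proof -
  let ?I = "top_of_set {0..1::real}"
  let ?h = "circ \<circ> (\<lambda>(s, t). (1 - s) * \<theta> t + s * t)"
  have "homotopic_with (\<lambda>r. r 1 = r 0) ?I (nsphere 1) (circ \<circ> \<theta>) circ"
    unfolding homotopic_with_def
  proof (intro exI conjI allI ballI)
    have \<theta>: "continuous_on {0..1} \<theta>"
      using assms(1) by simp
    have "continuous_on ({0..1} \<times> {0..1}) (\<lambda>x. (1 - fst x) * \<theta> (snd x) + fst x * snd x)"
      by (intro continuous_intros continuous_on_compose2 [OF \<theta>]) auto
    then have "continuous_map (prod_topology ?I ?I) euclideanreal (\<lambda>(s, t). (1 - s) * \<theta> t + s * t)"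
      by (simp add: case_prod_unfold)
    then show "continuous_map (prod_topology ?I ?I) (nsphere 1) ?h"
      by (rule continuous_map_compose [OF _ continuous_map_circ])
  qed (auto simp: assms circ_1)
  then have "homotopic_with (\<lambda>x. True) (nsphere 1) (nsphere 1) f id"
    by (rule homotopic_loops_imp_homotopic_circle_maps) (auto simp: f)
  then show ?thesis
    using Brouwer_degree2_homotopic by fastforce
qed

text \<open>Let \<open>a i\<close> be the image under \<open>g i\<close> of a generator
  \<open>b\<close> of the homology of the sphere. The maps \<open>f j\<close> act as dual
  coordinates on the \<open>a i\<close>, so applying \<open>f j\<close> to a relation isolates the
  exponent \<open>c j\<close>.\<close>

lemma Z_independent_homology_group:
  assumes g: "\<And>i. i < k \<Longrightarrow> continuous_map (nsphere n) X (g i)"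
    and f: "\<And>i. i < k \<Longrightarrow> continuous_map X (nsphere n) (f i)"
    and n: "n \<noteq> 0"
    and deg: "\<And>i j. \<lbrakk>i < k; j < k\<rbrakk> \<Longrightarrow> Brouwer_degree2 n (f j \<circ> g i) = (if i = j then 1 else 0)"
  shows "\<exists>a. Z_independent (homology_group n X) a k"
proof -
  let ?S = "homology_group n (nsphere n)" and ?H = "homology_group n X"
  have red: "reduced_homology_group n (nsphere n) = ?S"
    using n by (simp add: un_reduced_homology_group)
  interpret S: comm_group ?S by (rule abelian_homology_group)
  interpret H: comm_group ?H by (rule abelian_homology_group)
  obtain b where b: "b \<in> carrier ?S" and gen: "subgroup_generated ?S {b} = ?S"
    using cyclic_reduced_homology_group_nsphere [of n n] by (auto simp: cyclic_group_def red)
  \<comment> \<open>Order 0 encodes infinite order: the group generated by \<open>b\<close> is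
    isomorphic to the integers.\<close>
  have ord: "S.ord b = 0"
    using b gen iso_finite [OF reduced_homology_group_nsphere(1)[of n, unfolded red]]
    by (simp flip: S.infinite_cyclic_subgroup_order)
  define a where "a i = hom_induced n (nsphere n) {} X {} (g i) b" for i
  have a: "a i \<in> carrier ?H" for i
    unfolding a_def by (rule hom_induced_carrier)
  have "\<forall>j<k. c j = 0" if c: "finprod ?H (\<lambda>i. a i [^]\<^bsub>?H\<^esub> c i) {..<k} = \<one>\<^bsub>?H\<^esub>" for c :: "nat \<Rightarrow> int"
  proof (intro allI impI)
    fix j assume j: "j < k"
    let ?f = "hom_induced n X {} (nsphere n) {} (f j)"
    interpret F: group_hom ?H ?S ?f
      by unfold_locales (rule hom_induced_hom)
    have hom_fp: "?f (finprod ?H u I) = finprod ?S (\<lambda>i. ?f (u i)) I" if "finite I" "\<And>i. u i \<in> carrier ?H" for u and I :: "nat set"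
      using that
    proof (induction I rule: finite_induct)
      case empty
      show ?case
        by (simp only: H.finprod_empty S.finprod_empty F.hom_one)
    next
      case (insert i I)
      have "?f (u i \<otimes>\<^bsub>?H\<^esub> finprod ?H u I) = ?f (u i) \<otimes>\<^bsub>?S\<^esub> ?f (finprod ?H u I)"
        using insert.prems by (intro F.hom_mult H.finprod_closed) auto
      then show ?case
        using insert F.hom_closed by (simp add: H.finprod_insert S.finprod_insert Pi_iff)
    qed
    \<comment> \<open>By functoriality this is the action of \<open>f j \<circ> g i\<close> on
      \<open>b\<close>, and the Brouwer degree is the exponent of that action.\<close>
    have fa: "?f (a i) = b [^]\<^bsub>?S\<^esub> (if i = j then 1 else 0 :: int)" if "i < k" for i
    proof -
      have "?f (a i) = hom_induced n (nsphere n) {} (nsphere n) {} (f j \<circ> g i) b"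
        unfolding a_def by (rule hom_induced_compose') (use g f that j in auto)
      then show ?thesis
        using Brouwer_degree2 [of b n "f j \<circ> g i"] b deg [OF that j] by (simp add: red)
    qed
    have "\<one>\<^bsub>?S\<^esub> = ?f (finprod ?H (\<lambda>i. a i [^]\<^bsub>?H\<^esub> c i) {..<k})"
      by (simp only: c F.hom_one)
    also have "\<dots> = finprod ?S (\<lambda>i. ?f (a i [^]\<^bsub>?H\<^esub> c i)) {..<k}"
      by (rule hom_fp) (auto simp: a)
    also have "\<dots> = finprod ?S (\<lambda>i. if j = i then b [^]\<^bsub>?S\<^esub> c i else \<one>\<^bsub>?S\<^esub>) {..<k}"
    proof (rule S.finprod_cong')
      show "(\<lambda>i. if j = i then b [^]\<^bsub>?S\<^esub> c i else \<one>\<^bsub>?S\<^esub>) \<in> {..<k} \<rightarrow> carrier ?S"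
        using b S.one_closed by (auto simp del: one_relative_homology_group)
      show "?f (a i [^]\<^bsub>?H\<^esub> c i) = (if j = i then b [^]\<^bsub>?S\<^esub> c i else \<one>\<^bsub>?S\<^esub>)" if "i \<in> {..<k}" for i
        using that by (auto simp: F.hom_int_pow a fa b S.int_pow_pow S.int_pow_1)
    qed simp
    also have "\<dots> = b [^]\<^bsub>?S\<^esub> c j"
      using j by (intro S.finprod_singleton) (auto simp: b)
    finally have "b [^]\<^bsub>?S\<^esub> c j = \<one>\<^bsub>?S\<^esub>" by simp
    then show "c j = 0"
      using b ord by (simp add: S.int_pow_eq_id del: one_relative_homology_group)
  qed
  then show ?thesis
    unfolding Z_independent_def using a by (intro exI [of _ a]) auto
qed

section \<open>Realizations of order complexes\<close>

definition vertex :: "'b \<Rightarrow> 'b \<Rightarrow> real" where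
  "vertex x = (\<lambda>y. if y = x then 1 else 0)"

lemma openin_order_complex_realization:
  "openin (order_complex_realization P leq) U \<longleftrightarrow>
     U \<subseteq> (\<Union>\<sigma>\<in>chains_of P leq. simplex_of \<sigma>) \<and>
     (\<forall>\<sigma>\<in>chains_of P leq. openin (subtopology (powertop_real UNIV) (simplex_of \<sigma>)) (U \<inter> simplex_of \<sigma>))"
  unfolding order_complex_realization_def
  by (simp add: topology_inverse' [OF istopology_order_complex_realization])

lemma topspace_order_complex_realization:
  "topspace (order_complex_realization P leq) = (\<Union>\<sigma>\<in>chains_of P leq. simplex_of \<sigma>)"
proof (rule antisym)
  show "topspace (order_complex_realization P leq) \<subseteq> (\<Union>\<sigma>\<in>chains_of P leq. simplex_of \<sigma>)"
    using openin_topspace [of "order_complex_realization P leq"]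
    unfolding openin_order_complex_realization by blast
  have "openin (order_complex_realization P leq) (\<Union>\<sigma>\<in>chains_of P leq. simplex_of \<sigma>)"
    unfolding openin_order_complex_realization
  proof (intro conjI ballI subset_refl)
    fix \<sigma> assume "\<sigma> \<in> chains_of P leq"
    then have "(\<Union>\<sigma>\<in>chains_of P leq. simplex_of \<sigma>) \<inter> simplex_of \<sigma> =
        topspace (subtopology (powertop_real UNIV) (simplex_of \<sigma>))"
      by auto
    then show "openin (subtopology (powertop_real UNIV) (simplex_of \<sigma>))
        ((\<Union>\<sigma>\<in>chains_of P leq. simplex_of \<sigma>) \<inter> simplex_of \<sigma>)"
      by (metis openin_topspace)
  qed
  then show "(\<Union>\<sigma>\<in>chains_of P leq. simplex_of \<sigma>) \<subseteq> topspace (order_complex_realization P leq)"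
    by (rule openin_subset)
qed

text \<open>The preimage of an open set depends only on its trace on the simplex, where the weak
  topology is Euclidean.\<close>

lemma continuous_map_into_order_complex_realization:
  assumes f: "continuous_map X (powertop_real UNIV) f"
    and \<sigma>: "\<sigma> \<in> chains_of P leq" "\<And>x. x \<in> topspace X \<Longrightarrow> f x \<in> simplex_of \<sigma>"
  shows "continuous_map X (order_complex_realization P leq) f"
  unfolding continuous_map_alt
proof (intro conjI allI impI)
  have f': "continuous_map X (subtopology (powertop_real UNIV) (simplex_of \<sigma>)) f"
    using f \<sigma> by (auto simp: continuous_map_in_subtopology)
  fix U assume "openin (order_complex_realization P leq) U"
  with \<sigma> have "openin (subtopology (powertop_real UNIV) (simplex_of \<sigma>)) (U \<inter> simplex_of \<sigma>)"
    by (simp add: openin_order_complex_realization)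
  then have "openin X {x \<in> topspace X. f x \<in> U \<inter> simplex_of \<sigma>}"
    by (rule openin_continuous_map_preimage [OF f'])
  moreover have "{x \<in> topspace X. f x \<in> U \<inter> simplex_of \<sigma>} = f -` U \<inter> topspace X"
    using \<sigma> by blast
  ultimately show "openin X (f -` U \<inter> topspace X)" by simp
qed (use \<sigma> in \<open>auto simp: topspace_order_complex_realization\<close>)

text \<open>The universal property of the weak topology.\<close>

lemma continuous_map_from_order_complex_realization:
  assumes "\<And>\<sigma>. \<sigma> \<in> chains_of P leq \<Longrightarrow>
      continuous_map (subtopology (powertop_real UNIV) (simplex_of \<sigma>)) Y f"
  shows "continuous_map (order_complex_realization P leq) Y f"
  unfolding continuous_map_alt
proof (intro conjI allI impI)
  let ?X = "order_complex_realization P leq"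
  show "f \<in> topspace ?X \<rightarrow> topspace Y"
    using continuous_map_funspace [OF assms] by (fastforce simp: topspace_order_complex_realization)
  fix V assume V: "openin Y V"
  have "openin (subtopology (powertop_real UNIV) (simplex_of \<sigma>)) (f -` V \<inter> topspace ?X \<inter> simplex_of \<sigma>)"
    if \<sigma>: "\<sigma> \<in> chains_of P leq" for \<sigma>
  proof -
    have "f -` V \<inter> topspace ?X \<inter> simplex_of \<sigma> = {\<alpha> \<in> topspace (subtopology (powertop_real UNIV) (simplex_of \<sigma>)). f \<alpha> \<in> V}"
      using \<sigma> by (auto simp: topspace_order_complex_realization)
    then show ?thesis
      using openin_continuous_map_preimage [OF assms [OF \<sigma>] V] by simp
  qed
  then show "openin ?X (f -` V \<inter> topspace ?X)"
    by (auto simp: openin_order_complex_realization topspace_order_complex_realization)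
qed

section \<open>Paths along segments and edges\<close>

lemma pathin_segment:
  fixes \<alpha> \<beta> :: "'b \<Rightarrow> real"
  assumes "\<sigma> \<in> chains_of P leq" "\<alpha> \<in> simplex_of \<sigma>" "\<beta> \<in> simplex_of \<sigma>"
  shows "pathin (order_complex_realization P leq) (\<lambda>t x. (1 - t) * \<alpha> x + t * \<beta> x)"
  unfolding pathin_def
proof (rule continuous_map_into_order_complex_realization [OF _ assms(1)])
  show "continuous_map (top_of_set {0..1}) (powertop_real UNIV) (\<lambda>t x. (1 - t) * \<alpha> x + t * \<beta> x)"
    unfolding continuous_map_componentwise_UNIV
    by (auto intro!: continuous_intros)
  show "(\<lambda>x. (1 - t) * \<alpha> x + t * \<beta> x) \<in> simplex_of \<sigma>" if "t \<in> topspace (top_of_set {0..1})" for t :: real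
    using assms that
    by (auto simp: simplex_of_def sum.distrib simp flip: sum_distrib_left)
qed

lemma vertex_in_simplex_of: "\<lbrakk>finite \<sigma>; x \<in> \<sigma>\<rbrakk> \<Longrightarrow> vertex x \<in> simplex_of \<sigma>"
  by (auto simp: simplex_of_def vertex_def)

text \<open>Closed simplices are convex, so a segment joins each point to a vertex of a simplex
  containing it.\<close>

lemma path_component_of_vertex:
  assumes "\<alpha> \<in> topspace (order_complex_realization P leq)"
  obtains x where "x \<in> P" "path_component_of (order_complex_realization P leq) \<alpha> (vertex x)"
proof -
  obtain \<sigma> where \<sigma>: "\<sigma> \<in> chains_of P leq" "\<alpha> \<in> simplex_of \<sigma>"
    using assms by (auto simp: topspace_order_complex_realization)
  then obtain x where x: "x \<in> \<sigma>" "x \<in> P" "finite \<sigma>"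
    by (auto simp: chains_of_def)
  then show ?thesis
    using pathin_segment [OF \<sigma> vertex_in_simplex_of [of \<sigma> x]]
    by (intro that [of x]) (auto simp: path_component_of_def intro!: exI)
qed

text \<open>The set \<open>Z\<close> confines the path, later to points with a vanishing coordinate
  or vanishing angles. The case \<open>x = y\<close> is allowed and shows that a vertex lies in the
  space.\<close>

lemma path_component_of_edge:
  assumes xy: "x \<in> P" "y \<in> P" "leq x x" "leq y y" "leq x y \<or> leq y x"
    and Z: "\<And>t. t \<in> {0..1} \<Longrightarrow> (\<lambda>z. (1 - t) * vertex x z + t * vertex y z) \<in> Z"
  shows "path_component_of (subtopology (order_complex_realization P leq) Z) (vertex x) (vertex y)"
proof -
  have "{x, y} \<in> chains_of P leq"
    using xy by (auto simp: chains_of_def)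
  then have "pathin (order_complex_realization P leq) (\<lambda>t z. (1 - t) * vertex x z + t * vertex y z)"
    by (rule pathin_segment) (simp_all add: vertex_in_simplex_of)
  then show ?thesis
    using Z by (auto simp: path_component_of_def pathin_subtopology
        intro!: exI [of _ "\<lambda>t z. (1 - t) * vertex x z + t * vertex y z"])
qed

text \<open>For a union \<open>A\<close> of components of the link of \<open>v\<close>, the map \<open>circ \<circ> angle_at v A\<close> wraps every edge
  from \<open>v\<close> to \<open>A\<close> once around the circle and collapses the rest. The discontinuity of \<open>angle_at\<close>
  at \<open>v\<close> itself, where it jumps from 1 to 0, disappears after applying \<open>circ\<close>.\<close>

definition angle_at :: "'b \<Rightarrow> 'b set \<Rightarrow> ('b \<Rightarrow> real) \<Rightarrow> real" where
  "angle_at v A \<alpha> = (if \<exists>x\<in>A. \<alpha> x \<noteq> 0 then \<alpha> v else 0)"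

text \<open>It suffices to look at one simplex. If it contains \<open>v\<close> and a member of
  \<open>A\<close>, the closure property of \<open>A\<close> puts all its other vertices into
  \<open>A\<close>, so the map is \<open>circ\<close> of the coordinate at \<open>v\<close>.
  Otherwise the angle is constantly 0.\<close>

lemma continuous_map_circ_angle_at:
  assumes A: "\<And>x y. \<lbrakk>x \<in> A; y \<in> P; x \<noteq> v; y \<noteq> v; leq x y \<or> leq y x; leq v x \<or> leq x v; leq v y \<or> leq y v\<rbrakk> \<Longrightarrow> y \<in> A"
    and v: "v \<notin> A"
  shows "continuous_map (order_complex_realization P leq) (nsphere 1) (circ \<circ> angle_at v A)"
proof (rule continuous_map_from_order_complex_realization)
  fix \<sigma> assume \<sigma>: "\<sigma> \<in> chains_of P leq"
  let ?S = "subtopology (powertop_real UNIV) (simplex_of \<sigma>)"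
  show "continuous_map ?S (nsphere 1) (circ \<circ> angle_at v A)"
  proof (cases "v \<in> \<sigma> \<and> \<sigma> \<inter> A \<noteq> {}")
    case True
    have sub: "\<sigma> - {v} \<subseteq> A"
      using True \<sigma> A v unfolding chains_of_def by blast
    have fin: "finite \<sigma>" using \<sigma> by (auto simp: chains_of_def)
    have eq: "circ (\<alpha> v) = (circ \<circ> angle_at v A) \<alpha>" if "\<alpha> \<in> topspace ?S" for \<alpha>
    proof (cases "\<exists>x\<in>A. \<alpha> x \<noteq> 0")
      case False
      have "sum \<alpha> \<sigma> = \<alpha> v + sum \<alpha> (\<sigma> - {v})"
        using True fin by (simp add: sum.remove)
      also have "sum \<alpha> (\<sigma> - {v}) = 0"
        using False sub by (intro sum.neutral) blast
      finally have "\<alpha> v = 1"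
        using that by (auto simp: simplex_of_def)
      with False show ?thesis
        by (simp add: angle_at_def circ_1)
    qed (auto simp: angle_at_def)
    have "continuous_map ?S euclideanreal (\<lambda>\<alpha>. \<alpha> v)"
      by (intro continuous_map_from_subtopology continuous_map_product_coordinates) auto
    then have "continuous_map ?S (nsphere 1) (\<lambda>\<alpha>. circ (\<alpha> v))"
      using continuous_map_compose [OF _ continuous_map_circ] by (fastforce simp: o_def)
    then show ?thesis
      by (rule continuous_map_eq) (rule eq)
  next
    case False
    have eq: "circ 0 = (circ \<circ> angle_at v A) \<alpha>" if "\<alpha> \<in> topspace ?S" for \<alpha>
      using False that by (auto simp: angle_at_def simplex_of_def)
    have "continuous_map ?S (nsphere 1) (\<lambda>\<alpha>. circ 0)"
      using continuous_map_funspace [OF continuous_map_circ] by auto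
    then show ?thesis
      by (rule continuous_map_eq) (rule eq)
  qed
qed

text \<open>The loop follows \<open>p\<close>, along which all angles vanish, and closes up along
  the edge from \<open>x\<close> back to \<open>v\<close>. On that edge the coordinate at
  \<open>v\<close> rises from 0 to 1, and among the sets \<open>A j\<close> only \<open>A i\<close>
  registers this.\<close>

lemma detecting_loop:
  assumes p: "pathin (order_complex_realization P leq) p" "p 0 = vertex v" "p 1 = vertex x"
      "\<And>j t. \<lbrakk>j < k; t \<in> {0..1}\<rbrakk> \<Longrightarrow> angle_at v (A j) (p t) = 0"
    and vx: "v \<in> P" "x \<in> P" "leq v v" "leq x x" "leq v x \<or> leq x v"
    and vA: "\<And>j. j < k \<Longrightarrow> v \<notin> A j"
    and xA: "\<And>j. j < k \<Longrightarrow> x \<in> A j \<longleftrightarrow> j = i"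
  obtains q where "pathin (order_complex_realization P leq) q" "q 1 = q 0"
    "\<And>j t. \<lbrakk>j < k; t \<in> {0..1}\<rbrakk> \<Longrightarrow>
        circ (angle_at v (A j) (q t)) = (if j = i then circ (max 0 (2 * t - 1)) else circ 0)"
proof -
  let ?X = "order_complex_realization P leq" and ?I = "top_of_set {0..1::real}"
  let ?e = "\<lambda>t z. (1 - t) * vertex x z + t * vertex v z"
  define q where "q t = (if t \<le> 1/2 then (p \<circ> (\<lambda>t. 2 * t)) t else (?e \<circ> (\<lambda>t. 2 * t - 1)) t)" for t
  have "{x, v} \<in> chains_of P leq"
    using vx by (auto simp: chains_of_def)
  then have e: "pathin ?X ?e"
    by (rule pathin_segment) (simp_all add: vertex_in_simplex_of)
  have "continuous_map ?I ?X q"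
    unfolding q_def
  proof (intro continuous_map_cases_le continuous_map_compose, force, force)
    show "continuous_map (subtopology ?I {x \<in> topspace ?I. x \<le> 1/2}) ?I ((*) 2)"
      by (auto simp: continuous_map_in_subtopology continuous_map_from_subtopology)
    have "continuous_map
           (subtopology ?I {x. 0 \<le> x \<and> x \<le> 1 \<and> 1 \<le> x * 2}) euclideanreal (\<lambda>t. 2 * t - 1)"
      by (intro continuous_intros) (force intro: continuous_map_from_subtopology)
    then show "continuous_map (subtopology ?I {x \<in> topspace ?I. 1/2 \<le> x}) ?I (\<lambda>t. 2 * t - 1)"
      by (force simp: continuous_map_in_subtopology)
    show "(p \<circ> (*) 2) t = (?e \<circ> (\<lambda>t. 2 * t - 1)) t" if "t \<in> topspace ?I" "t = 1/2" for t
      unfolding that(2) by (simp add: p)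
  qed (use p(1) e in \<open>auto simp: pathin_def\<close>)
  then have q: "pathin ?X q" by (simp add: pathin_def)
  have q1: "q 1 = q 0"
    by (simp add: q_def p)
  have "circ (angle_at v (A j) (q t)) = (if j = i then circ (max 0 (2 * t - 1)) else circ 0)"
    if j: "j < k" and t: "t \<in> {0..1}" for j t
  proof (cases "t \<le> 1/2")
    case True
    then have "angle_at v (A j) (q t) = 0"
      using p(4) [OF j, of "2 * t"] t by (simp add: q_def)
    moreover have "max 0 (2 * t - 1) = 0"
      using True by simp
    ultimately show ?thesis by simp
  next
    case False
    consider "j \<noteq> i" | "j = i" "t < 1" | "j = i" "t = 1"
      using t by fastforce
    then show ?thesis
    proof cases
      case 1
      with xA [OF j] vA [OF j] have "\<not> (\<exists>z\<in>A j. ?e (2 * t - 1) z \<noteq> 0)"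
        by (auto simp: vertex_def)
      then have "angle_at v (A j) (q t) = 0"
        using False by (simp add: q_def angle_at_def)
      with 1 show ?thesis by simp
    next
      \<comment> \<open>Before the end, the coordinate at \<open>x\<close> is
        \<open>2 - 2 * t\<close>, which is nonzero, so \<open>angle_at\<close> reads off the
        coordinate \<open>2 * t - 1\<close> at \<open>v\<close>.\<close>
      case 2
      have x: "x \<in> A j" "x \<noteq> v"
        using xA [OF j] vA [OF j] 2 by auto
      moreover have "?e (2 * t - 1) x \<noteq> 0"
        using x 2 by (simp add: vertex_def)
      ultimately have "angle_at v (A j) (q t) = ?e (2 * t - 1) v"
        using False by (auto simp: q_def angle_at_def)
      with x 2 False show ?thesis
        by (simp add: vertex_def max_def)
    next
      \<comment> \<open>At \<open>v\<close> itself \<open>angle_at\<close> falls back to 0 where the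
        formula gives 1; \<open>circ\<close> identifies the two.\<close>
      case 3
      then have "\<not> (\<exists>z\<in>A j. q t z \<noteq> 0)"
        using vA [OF j] by (auto simp: q_def vertex_def)
      then have "angle_at v (A j) (q t) = 0"
        by (simp add: angle_at_def)
      with 3 show ?thesis by (simp add: circ_1)
    qed
  qed
  with q q1 show ?thesis
    using that by blast
qed

section \<open>The coset poset\<close>

text \<open>Every component contains a vertex. The infinite case is a separate alternative because
  \<open>card\<close> is 0 there. Of the k + 1 chosen vertices, the one with index \<open>k\<close>
  will mark the base component.\<close>

lemma many_path_components_vertices:
  fixes P :: "'b set" and leq :: "'b \<Rightarrow> 'b \<Rightarrow> bool"
  defines "Y \<equiv> order_complex_realization P leq"
  assumes "infinite (path_components_of Y) \<or> Suc k \<le> card (path_components_of Y)"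
  obtains h where "\<And>i. i \<le> k \<Longrightarrow> h i \<in> P"
    "\<And>i j. \<lbrakk>i \<le> k; j \<le> k; path_component_of Y (vertex (h i)) (vertex (h j))\<rbrakk> \<Longrightarrow> i = j"
proof -
  obtain S where S: "S \<subseteq> path_components_of Y" "card S = Suc k" "finite S"
    using assms(2) infinite_arbitrarily_large obtain_subset_with_card_n by metis
  obtain c where c: "bij_betw c {0..<Suc k} S"
    using ex_bij_betw_nat_finite [OF S(3)] S(2) by metis
  have cY: "c i \<in> path_components_of Y" if "i \<le> k" for i
    using bij_betwE [OF c] S(1) that by auto
  have "\<exists>x. x \<in> P \<and> vertex x \<in> c i" if i: "i \<le> k" for i
  proof -
    obtain \<alpha> where \<alpha>: "\<alpha> \<in> topspace Y" "c i = path_component_of_set Y \<alpha>"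
      using cY [OF i] by (auto simp: path_components_of_def)
    obtain x where "x \<in> P" "path_component_of Y \<alpha> (vertex x)"
      using path_component_of_vertex \<alpha>(1) unfolding Y_def by metis
    with \<alpha> show ?thesis by auto
  qed
  then obtain h where h: "\<And>i. i \<le> k \<Longrightarrow> h i \<in> P \<and> vertex (h i) \<in> c i"
    by metis
  have "i = j" if ij: "i \<le> k" "j \<le> k" and pc: "path_component_of Y (vertex (h i)) (vertex (h j))" for i j
  proof -
    obtain \<alpha> where "c i = path_component_of_set Y \<alpha>"
      using cY [OF ij(1)] by (auto simp: path_components_of_def)
    then have "vertex (h j) \<in> c i"
      using h [OF ij(1)] pc path_component_of_trans by fastforce
    then have "c i = c j"
      using path_components_of_overlap [OF cY [OF ij(1)] cY [OF ij(2)]] h [OF ij(2)] by blast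
    then show ?thesis
      using bij_betw_imp_inj_on [OF c] ij by (auto dest: inj_onD)
  qed
  with h show ?thesis
    using that by blast
qed

section \<open>Cosets and the link of the trivial subgroup\<close>

lemma (in group) mem_l_coset_self:
  assumes "x \<in> carrier G" "subgroup H G"
  shows "x \<in> x <# H"
  using assms(1) subgroup.one_closed [OF assms(2)] by (force simp: l_coset_def intro: bexI [of _ \<one>])

lemma (in group) l_coset_in_coset_poset:
  "\<lbrakk>x \<in> carrier G; subgroup H G; H \<noteq> carrier G\<rbrakk> \<Longrightarrow> x <# H \<in> coset_poset G"
  by (auto simp: coset_poset_def)

lemma (in group) subgroup_if_one_in_coset_poset:
  assumes "C \<in> coset_poset G" "\<one> \<in> C"
  shows "subgroup C G" "C \<noteq> carrier G"
proof -
  obtain x H where "x \<in> carrier G" "subgroup H G" "H \<noteq> carrier G" "C = x <# H"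
    using assms(1) by (auto simp: coset_poset_def)
  moreover from this have "C = H"
    using l_repr_independence [of \<one> x H] lcos_mult_one [of H] assms(2) subgroup.subset by metis
  ultimately show "subgroup C G" "C \<noteq> carrier G" by auto
qed

lemma (in group) proper_subgroup_in_coset_poset:
  assumes "subgroup H G" "H \<noteq> carrier G"
  shows "H \<in> coset_poset G"
  using l_coset_in_coset_poset [OF one_closed assms] lcos_mult_one [OF subgroup.subset [OF assms(1)]]
  by simp

lemma (in group) nonempty_in_coset_poset:
  assumes "C \<in> coset_poset G"
  shows "C \<noteq> {}"
proof -
  obtain x H where "x \<in> carrier G" "subgroup H G" "C = x <# H"
    using assms by (auto simp: coset_poset_def)
  then show ?thesis
    using mem_l_coset_self by blast
qed

text \<open>This identifies the link of \<open>{\<one>}\<close>: cosets are nonempty, so one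
  comparable to \<open>{\<one>}\<close> contains the identity and is a subgroup.\<close>

lemma (in group) in_subgroup_poset_if_comparable:
  assumes "C \<in> coset_poset G" "C \<noteq> {\<one>}" "{\<one>} \<subseteq> C \<or> C \<subseteq> {\<one>}"
  shows "C \<in> subgroup_poset G"
  using assms nonempty_in_coset_poset subgroup_if_one_in_coset_poset
  by (auto simp: subgroup_poset_def)

text \<open>Consecutive cosets in H, {h}, hK, {hk}, Hk, {k}, K are nested. If hk is not the
  identity, none of them is \<open>{\<one>}\<close>, since hK contains h and Hk contains k.\<close>

lemma (in group) subgroup_poset_path_avoiding_one:
  assumes H: "H \<in> subgroup_poset G" and K: "K \<in> subgroup_poset G"
  shows "path_component_of (subtopology (order_complex_realization (coset_poset G) (\<subseteq>)) {\<alpha>. \<alpha> {\<one>} = 0})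
           (vertex H) (vertex K)"
proof -
  let ?R = "\<lambda>x y. path_component_of
      (subtopology (order_complex_realization (coset_poset G) (\<subseteq>)) {\<alpha>. \<alpha> {\<one>} = 0}) (vertex x) (vertex y)"
  have edge: "?R C D" if "C \<in> coset_poset G" "D \<in> coset_poset G" "C \<subseteq> D \<or> D \<subseteq> C" "C \<noteq> {\<one>}" "D \<noteq> {\<one>}" for C D
    using that by (intro path_component_of_edge) (auto simp: vertex_def)
  have trans [trans]: "?R C E" if "?R C D" "?R D E" for C D E
    using that by (rule path_component_of_trans)
  have sub: "subgroup H G" "subgroup K G" "H \<noteq> carrier G" "K \<noteq> carrier G" "H \<noteq> {\<one>}" "K \<noteq> {\<one>}"
    using H K by (auto simp: subgroup_poset_def)
  note HK = proper_subgroup_in_coset_poset [OF sub(1,3)] proper_subgroup_in_coset_poset [OF sub(2,4)]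
  note one = subgroup.one_closed [OF sub(1)] subgroup.one_closed [OF sub(2)]
  obtain h where h: "h \<in> H" "h \<noteq> \<one>"
    using sub(5) one(1) by blast
  obtain k where k: "k \<in> K" "k \<noteq> \<one>"
    using sub(6) one(2) by blast
  have carr: "h \<in> carrier G" "k \<in> carrier G"
    using subgroup.mem_carrier [OF sub(1) h(1)] subgroup.mem_carrier [OF sub(2) k(1)] .
  have sing: "{x} \<in> coset_poset G" if "x \<in> carrier G" for x
  proof -
    have "{\<one>} \<noteq> carrier G" using carr h by auto
    moreover have "{x} = x <# {\<one>}" using that by (auto simp: l_coset_def)
    ultimately show ?thesis
      using l_coset_in_coset_poset [OF that triv_subgroup] by simp
  qed
  have Hh: "?R H {h}" and Kk: "?R {k} K"
    using HK h k sing carr sub(5,6) by (auto intro!: edge)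
  show ?thesis
  proof (cases "h \<otimes> k = \<one>")
    \<comment> \<open>Here {hk} would be the forbidden vertex, but h, the inverse of k, lies in
      \<open>K\<close>, and H, {h}, K is already a path.\<close>
    case True
    then have "h = inv k"
      using carr by (simp add: inv_equality)
    then have "h \<in> K"
      using subgroup.m_inv_closed [OF sub(2) k(1)] by simp
    then have "?R {h} K"
      using HK h sing carr sub(6) by (intro edge) auto
    with Hh show ?thesis by (rule trans)
  next
    case False
    \<comment> \<open>The conjugate k^-1 H k, written as a preimage of \<open>H\<close> so that its
      closure properties come from those of \<open>H\<close>.\<close>
    let ?M = "{x \<in> carrier G. k \<otimes> x \<otimes> inv k \<in> H}"
    have conj1: "k \<otimes> (inv k \<otimes> y \<otimes> k) = y \<otimes> k" if "y \<in> carrier G" for y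
      using that carr by (simp flip: m_assoc)
    have conj2: "k \<otimes> (inv k \<otimes> y \<otimes> k) \<otimes> inv k = y" if "y \<in> carrier G" for y
      using that carr by (simp add: conj1) (simp add: m_assoc)
    have M: "subgroup ?M G"
    proof
      fix x y assume x: "x \<in> ?M" and y: "y \<in> ?M"
      have "k \<otimes> (x \<otimes> y) \<otimes> inv k = (k \<otimes> x \<otimes> inv k) \<otimes> (k \<otimes> y \<otimes> inv k)"
        using x y carr by (simp add: m_assoc inv_solve_left)
      then show "x \<otimes> y \<in> ?M"
        using x y subgroup.m_closed [OF sub(1)] by simp
    next
      fix x assume x: "x \<in> ?M"
      have "k \<otimes> inv x \<otimes> inv k = inv (k \<otimes> x \<otimes> inv k)"
        using x carr by (simp add: inv_mult_group m_assoc)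
      then show "inv x \<in> ?M"
        using x subgroup.m_inv_closed [OF sub(1)] by simp
    qed (use carr one(1) in auto)
    have "?M \<noteq> carrier G"
    proof
      assume eq: "?M = carrier G"
      \<comment> \<open>Each y is the conjugate by k of k^-1 y k, so \<open>H\<close> would be the
        whole group.\<close>
      have "y \<in> H" if y: "y \<in> carrier G" for y
      proof -
        have "inv k \<otimes> y \<otimes> k \<in> ?M"
          using eq y carr by simp
        then show ?thesis
          by (simp add: conj2 y)
      qed
      then show False
        using subgroup.subset [OF sub(1)] sub(3) by blast
    qed
    with M have kM: "k <# ?M \<in> coset_poset G"
      by (intro l_coset_in_coset_poset carr(2))
    have k_in: "k \<in> k <# ?M"
      using mem_l_coset_self [OF carr(2) M] .
    have "inv k \<otimes> h \<otimes> k \<in> ?M"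
      using carr h(1) by (simp add: conj2)
    then have "k \<otimes> (inv k \<otimes> h \<otimes> k) \<in> k <# ?M"
      unfolding l_coset_def by blast
    then have hk_in: "h \<otimes> k \<in> k <# ?M"
      by (simp only: conj1 [OF carr(1)])
    have hK: "h <# K \<in> coset_poset G" "h \<in> h <# K" "h \<otimes> k \<in> h <# K"
      using l_coset_in_coset_poset [OF carr(1) sub(2,4)] k mem_l_coset_self [OF carr(1) sub(2)]
      by (auto simp: l_coset_def)
    txt \<open>The left coset \<open>kM\<close> is the right coset \<open>Hk\<close>.\<close>
    have "?R {h} (h <# K)"
      using hK h carr sing by (intro edge) auto
    moreover have "?R (h <# K) {h \<otimes> k}"
      using hK h carr sing False by (intro edge) auto
    moreover have "?R {h \<otimes> k} (k <# ?M)"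
      using hk_in k_in kM k carr sing False by (intro edge) auto
    moreover have "?R (k <# ?M) {k}"
      using k_in kM k carr sing by (intro edge) auto
    ultimately show ?thesis
      using Hh Kk trans by blast
  qed
qed

section \<open>Loops through the trivial subgroup\<close>

text \<open>The i-th loop runs from \<open>{\<one>}\<close> to \<open>h k\<close>, on to
  \<open>h i\<close> away from \<open>{\<one>}\<close>, and back along an edge. The map
  \<open>f j\<close> watches the component of \<open>h j\<close>; since j < k, none watches the base
  component.\<close>

lemma (in group) coset_poset_detecting_loops:
  fixes k :: nat
  defines "X \<equiv> order_complex_realization (coset_poset G) (\<subseteq>)"
    and "Y \<equiv> order_complex_realization (subgroup_poset G) (\<subseteq>)"
  assumes "infinite (path_components_of Y) \<or> Suc k \<le> card (path_components_of Y)"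
  shows "\<exists>q f. \<forall>i<k. pathin X (q i) \<and> q i 1 = q i 0 \<and> continuous_map X (nsphere 1) (f i) \<and>
    (\<forall>j<k. \<forall>t\<in>{0..1}. f j (q i t) = (if j = i then circ (max 0 (2 * t - 1)) else circ 0))"
proof -
  obtain h where h: "\<And>i. i \<le> k \<Longrightarrow> h i \<in> subgroup_poset G"
    "\<And>i j. \<lbrakk>i \<le> k; j \<le> k; path_component_of Y (vertex (h i)) (vertex (h j))\<rbrakk> \<Longrightarrow> i = j"
    using many_path_components_vertices assms(3) unfolding Y_def by metis
  define A where "A i = {H \<in> subgroup_poset G. path_component_of Y (vertex (h i)) (vertex H)}" for i
  have LC: "H \<in> coset_poset G" "\<one> \<in> H" "H \<noteq> {\<one>}" if "H \<in> subgroup_poset G" for H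
    using that proper_subgroup_in_coset_poset subgroup.one_closed by (auto simp: subgroup_poset_def)
  have "{\<one>} \<noteq> carrier G"
    using LC(2,3) [OF h(1) [of 0]] subgroup.subset [of "h 0" G] h(1) [of 0]
    by (auto simp: subgroup_poset_def)
  then have one: "{\<one>} \<in> coset_poset G"
    by (intro proper_subgroup_in_coset_poset triv_subgroup)
  have oneA: "{\<one>} \<notin> A j" for j
    by (auto simp: A_def subgroup_poset_def)
  have "vertex H \<in> topspace Y" if "H \<in> subgroup_poset G" for H
    using path_component_of_edge [of H "subgroup_poset G" H "(\<subseteq>)" UNIV] that
      path_component_in_topspace [of Y "vertex H" "vertex H"]
    by (simp add: Y_def)
  then have hA: "h i \<in> A j \<longleftrightarrow> j = i" if "i \<le> k" "j \<le> k" for i j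
    using h that path_component_of_refl [of Y] by (auto simp: A_def)
  have cont: "continuous_map X (nsphere 1) (circ \<circ> angle_at {\<one>} (A j))" for j
    unfolding X_def
  proof (rule continuous_map_circ_angle_at)
    fix H K
    assume HK: "H \<in> A j" "K \<in> coset_poset G" "K \<noteq> {\<one>}" "H \<subseteq> K \<or> K \<subseteq> H" "{\<one>} \<subseteq> K \<or> K \<subseteq> {\<one>}"
    then have K: "K \<in> subgroup_poset G" and H: "H \<in> subgroup_poset G"
      by (simp_all add: in_subgroup_poset_if_comparable A_def)
    then have "path_component_of Y (vertex H) (vertex K)"
      using path_component_of_edge [of H "subgroup_poset G" K "(\<subseteq>)" UNIV] HK by (simp add: Y_def)
    then show "K \<in> A j"
      using HK K path_component_of_trans by (fastforce simp: A_def)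
  qed (rule oneA)
  have "\<exists>q. pathin X q \<and> q 1 = q 0 \<and> (\<forall>j t. j < k \<and> t \<in> {0..1} \<longrightarrow>
      circ (angle_at {\<one>} (A j) (q t)) = (if j = i then circ (max 0 (2 * t - 1)) else circ 0))"
    if i: "i < k" for i
  proof -
    \<comment> \<open>Points at which every angle vanishes, as \<open>detecting_loop\<close>
      requires of the first leg.\<close>
    let ?Z = "{\<alpha>. \<forall>j<k. angle_at {\<one>} (A j) \<alpha> = 0}"
    have Lh: "h i \<in> subgroup_poset G" "h k \<in> subgroup_poset G"
      using h(1) i by auto
    have notA: "h k \<notin> A j" if "j < k" for j
      using hA that by auto
    have "path_component_of (subtopology X ?Z) (vertex {\<one>}) (vertex (h k))"
      unfolding X_def
    proof (rule path_component_of_edge)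
      fix t :: real assume "t \<in> {0..1}"
      have "(1 - t) * vertex {\<one>} z + t * vertex (h k) z = 0" if "j < k" "z \<in> A j" for z j
        using notA [OF that(1)] oneA that(2) by (auto simp: vertex_def)
      then show "(\<lambda>z. (1 - t) * vertex {\<one>} z + t * vertex (h k) z) \<in> ?Z"
        by (auto simp: angle_at_def)
    qed (use one LC [OF Lh(2)] in auto)
    \<comment> \<open>An angle is either the coordinate at \<open>{\<one>}\<close> or 0, so the path
      avoiding \<open>{\<one>}\<close> stays in \<open>?Z\<close>.\<close>
    moreover have "path_component_of (subtopology X ?Z) (vertex (h k)) (vertex (h i))"
      using subgroup_poset_path_avoiding_one [OF Lh(2,1)] unfolding X_def
      by (rule path_component_of_mono) (auto simp: angle_at_def)
    ultimately have "path_component_of (subtopology X ?Z) (vertex {\<one>}) (vertex (h i))"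
      by (rule path_component_of_trans)
    then obtain p where p: "pathin X p" "p 0 = vertex {\<one>}" "p 1 = vertex (h i)" "\<And>t. t \<in> {0..1} \<Longrightarrow> p t \<in> ?Z"
      by (auto simp: path_component_of_def pathin_subtopology)
    obtain q where "pathin X q" "q 1 = q 0"
      "\<And>j t. \<lbrakk>j < k; t \<in> {0..1}\<rbrakk> \<Longrightarrow>
        circ (angle_at {\<one>} (A j) (q t)) = (if j = i then circ (max 0 (2 * t - 1)) else circ 0)"
      unfolding X_def
    proof (rule detecting_loop [OF p(1)[unfolded X_def] p(2,3), where A = A and k = k and i = i])
      show "h i \<in> A j \<longleftrightarrow> j = i" if "j < k" for j
        using hA i that by auto
    qed (use p(4) one oneA LC [OF Lh(1)] in auto)
    then show ?thesis by blast
  qed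
  then obtain q where "\<And>i. i < k \<Longrightarrow> pathin X (q i) \<and> q i 1 = q i 0 \<and> (\<forall>j t. j < k \<and> t \<in> {0..1} \<longrightarrow>
      circ (angle_at {\<one>} (A j) (q i t)) = (if j = i then circ (max 0 (2 * t - 1)) else circ 0))"
    by metis
  then show ?thesis
    using cont by (intro exI [of _ q] exI [of _ "\<lambda>j. circ \<circ> angle_at {\<one>} (A j)"]) simp
qed

section \<open>Conclusion by degrees\<close>

text \<open>The angle rests at 0 for half the time and then makes exactly one turn.\<close>

lemma Brouwer_degree2_detecting_loop:
  assumes "\<And>t. t \<in> {0..1} \<Longrightarrow> f (circ t) = circ (max 0 (2 * t - 1))"
  shows "Brouwer_degree2 1 f = 1"
  by (rule Brouwer_degree2_circle [where \<theta> = "\<lambda>t. max 0 (2 * t - 1)"])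
    (auto simp: assms intro!: continuous_intros)

theorem mainTheorem12:
  fixes G :: "('a, 'm) monoid_scheme"
  assumes "group G"
  shows "(\<forall>k::nat.
            (infinite (path_components_of (order_complex_realization (subgroup_poset G) (\<subseteq>))) \<or>
             Suc k \<le> card (path_components_of (order_complex_realization (subgroup_poset G) (\<subseteq>))))
            \<longrightarrow> (\<exists>g. Z_independent (homology_group 1 (order_complex_realization (coset_poset G) (\<subseteq>))) g k))
       \<and> (\<not> connected_space (order_complex_realization (subgroup_poset G) (\<subseteq>))
            \<longrightarrow> \<not> simply_connected_space (order_complex_realization (coset_poset G) (\<subseteq>)))"
proof (intro conjI allI impI)
  interpret group G by (rule assms)
  let ?X = "order_complex_realization (coset_poset G) (\<subseteq>)"
  let ?Y = "order_complex_realization (subgroup_poset G) (\<subseteq>)"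
  {
    fix k :: nat
    assume "infinite (path_components_of ?Y) \<or> Suc k \<le> card (path_components_of ?Y)"
    from coset_poset_detecting_loops [OF this] obtain q f
      where qf: "\<forall>i<k. pathin ?X (q i) \<and> q i 1 = q i 0 \<and> continuous_map ?X (nsphere 1) (f i) \<and>
        (\<forall>j<k. \<forall>t\<in>{0..1}. f j (q i t) = (if j = i then circ (max 0 (2 * t - 1)) else circ 0))"
      by (elim exE)
    have q: "pathin ?X (q i)" "q i 1 = q i 0" and f: "continuous_map ?X (nsphere 1) (f i)" if "i < k" for i
      using qf that by simp_all
    have fq: "f j (q i t) = (if j = i then circ (max 0 (2 * t - 1)) else circ 0)"
      if "i < k" "j < k" "t \<in> {0..1}" for i j t
      using qf that by simp
    have "\<exists>g. continuous_map (nsphere 1) ?X g \<and> (\<forall>t\<in>{0..1}. g (circ t) = q i t)" if i: "i < k" for i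
    proof -
      obtain g where "continuous_map (nsphere 1) ?X g" "\<And>t. t \<in> {0..1} \<Longrightarrow> g (circ t) = q i t"
        using q [OF i] by (rule loop_factors_through_circle) simp
      then show ?thesis by auto
    qed
    then have "\<forall>i. \<exists>g. i < k \<longrightarrow> continuous_map (nsphere 1) ?X g \<and> (\<forall>t\<in>{0..1}. g (circ t) = q i t)"
      by simp
    from choice [OF this] obtain g
      where g': "\<forall>i<k. continuous_map (nsphere 1) ?X (g i) \<and> (\<forall>t\<in>{0..1}. g i (circ t) = q i t)"
      by (elim exE)
    have g: "continuous_map (nsphere 1) ?X (g i)" "t \<in> {0..1} \<Longrightarrow> g i (circ t) = q i t" if "i < k" for i t
      using g' that by simp_all
    have "Brouwer_degree2 1 (f j \<circ> g i) = (if i = j then 1 else 0)" if ij: "i < k" "j < k" for i j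
    proof (cases "i = j")
      case True
      then have "Brouwer_degree2 1 (f j \<circ> g i) = 1"
        using ij by (intro Brouwer_degree2_detecting_loop) (simp add: g fq)
      with True show ?thesis by simp
    next
      \<comment> \<open>The j-th map collapses the i-th loop to a point, and constant maps have
        degree 0.\<close>
      case False
      have "(f j \<circ> g i) x = circ 0" if x: "x \<in> topspace (nsphere 1)" for x
      proof -
        obtain t where "t \<in> {0..1}" "x = circ t"
          using x unfolding circ_image [symmetric] by blast
        then show ?thesis
          using ij False by (simp add: g fq)
      qed
      then have "Brouwer_degree2 1 (f j \<circ> g i) = Brouwer_degree2 1 (\<lambda>x. circ 0)"
        by (rule Brouwer_degree2_eq)
      with False show ?thesis
        by (simp add: Brouwer_degree2_const)
    qed
    then show "\<exists>a. Z_independent (homology_group 1 ?X) a k"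
      using Z_independent_homology_group [of k 1 ?X g f] g f by simp
  }
  assume "\<not> connected_space ?Y"
  then have "\<not> path_connected_space ?Y"
    using path_connected_imp_connected_space by blast
  then obtain \<alpha> \<beta> where \<alpha>\<beta>: "\<alpha> \<in> topspace ?Y" "\<beta> \<in> topspace ?Y" "\<not> path_component_of ?Y \<alpha> \<beta>"
    by (auto simp: path_connected_space_iff_path_component)
  \<comment> \<open>Two path components are the case k = 1, which provides one detecting
    loop.\<close>
  let ?C = "{path_component_of_set ?Y \<alpha>, path_component_of_set ?Y \<beta>}"
  have C: "?C \<subseteq> path_components_of ?Y"
    using \<alpha>\<beta> by (auto simp: path_components_of_def)
  have "path_component_of_set ?Y \<alpha> \<noteq> path_component_of_set ?Y \<beta>"
    using \<alpha>\<beta> path_component_of_refl [of ?Y \<beta>] by blast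
  then have "card ?C = Suc 1"
    by simp
  then have "infinite (path_components_of ?Y) \<or> Suc 1 \<le> card (path_components_of ?Y)"
    using card_mono [OF _ C] by auto
  from coset_poset_detecting_loops [OF this] obtain q f
    where q: "pathin ?X (q 0)" "q 0 1 = q 0 0" and f: "continuous_map ?X (nsphere 1) (f 0)"
      and fq: "\<And>t. t \<in> {0..1} \<Longrightarrow> f (0 :: nat) (q (0 :: nat) t) = circ (max 0 (2 * t - 1))"
    by auto
  obtain g where g: "continuous_map (nsphere 1) ?X g" "\<And>t. t \<in> {0..1} \<Longrightarrow> g (circ t) = q 0 t"
    using loop_factors_through_circle [OF q] by auto
  show "\<not> simply_connected_space ?X"
  proof
    assume sc: "simply_connected_space ?X"
    have "q 0 0 \<in> topspace ?X"
      using q(1) by (auto simp: pathin_def continuous_map_def)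
    then have "pathin ?X (\<lambda>t. q 0 0)"
      by (simp add: pathin_const)
    \<comment> \<open>Comparing the loop with a constant one would make a map of degree 1 homotopic
      to a constant map of the circle.\<close>
    then have "homotopic_with (\<lambda>r. r 1 = r 0) (top_of_set {0..1}) ?X (q 0) (\<lambda>t. q 0 0)"
      using sc q unfolding simply_connected_space_def by simp
    then have "homotopic_with (\<lambda>x. True) (nsphere 1) ?X g (\<lambda>x. q 0 0)"
      by (rule homotopic_loops_imp_homotopic_circle_maps) (auto simp: g)
    then have "homotopic_with (\<lambda>x. True) (nsphere 1) (nsphere 1) (f 0 \<circ> g) (f 0 \<circ> (\<lambda>x. q 0 0))"
      by (rule homotopic_with_compose_continuous_map_left) (auto simp: f)
    then have "Brouwer_degree2 1 (f 0 \<circ> g) = Brouwer_degree2 1 (\<lambda>x. f 0 (q 0 0))"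
      by (simp add: Brouwer_degree2_homotopic o_def)
    moreover have "Brouwer_degree2 1 (f 0 \<circ> g) = 1"
      by (rule Brouwer_degree2_detecting_loop) (simp add: g fq)
    ultimately show False
      by (simp add: Brouwer_degree2_const)
  qed
qed

end
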